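(* Let $m \geq 3$ be an integer and let $G$ and $G'$ be $m$-edge-coloured graphs. Then $G$ and $G'$ are $S_m$-switch equivalent if and only if $\mathit{underlying}(G) \cong \mathit{underlying}(G')$.
   Context: Graphs are finite, undirected and simple (no loops, no multiple edges). An $m$-edge-coloured graph is a pair $G=(H,\Sigma)$ where $H$ is a graph and $\Sigma: E(H)\to\{1,\dots,m\}$ is any function; $\Sigma(e)$ is the colour of $e$. We write $\mathit{underlying}(G)=H$ and $\Sigma(G)=\Sigma$. An isomorphism of $m$-edge-coloured graphs is an isomorphism of the underlying graphs that preserves edge colours. $S_m$ is the symmetric group on $\{1,\dots,m\}$. Let $\Gamma$ be a subgroup of $S_m$. For a vertex $x$ of $G$ and $\pi\in\Gamma$, switching at $x$ with respect to $\pi$ transforms $G$ into the $m$-edge-coloured graph $G^{(x,\pi)}$ with the same underlying graph, in which each edge $xy$ incident with $x$ has colour $\pi(\Sigma(G)(xy))$ and all other edges keep their colours. A $\Gamma$-switching sequence is a finite sequence $\mathcal{S}=(x_1,\pi_1),\dots,(x_t,\pi_t)$ of elements of $V(G)\times\Gamma$, and $G^{\mathcal{S}}$ is the result of performing these switches successively in order. $G$ and $G'$ are $\Gamma$-switch equivalent if there is a $\Gamma$-switching sequence $\mathcal{S}$ with $G^{\mathcal{S}}\cong G'$ (isomorphism of $m$-edge-coloured graphs). *)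

theory Defs
  imports "HOL-Algebra.Sym_Groups" "HOL-Library.FuncSet"
begin

record 'a ugraph =
  verts :: "'a set"
  edges :: "'a set set"

(* An edge with end vertices x and y is the two-element set {x, y}. *)
definition simple_graph :: "'a ugraph \<Rightarrow> bool" where
  "simple_graph H \<longleftrightarrow> finite (verts H) \<and> (\<forall>e\<in>edges H. e \<subseteq> verts H \<and> card e = 2)"

definition graph_iso :: "'a ugraph \<Rightarrow> 'b ugraph \<Rightarrow> ('a \<Rightarrow> 'b) \<Rightarrow> bool" where
  "graph_iso H H' f \<longleftrightarrow> bij_betw f (verts H) (verts H') \<and>
     (\<forall>x\<in>verts H. \<forall>y\<in>verts H. {x, y} \<in> edges H \<longleftrightarrow> {f x, f y} \<in> edges H')"

definition graph_isomorphic :: "'a ugraph \<Rightarrow> 'b ugraph \<Rightarrow> bool" where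
  "graph_isomorphic H H' \<longleftrightarrow> (\<exists>f. graph_iso H H' f)"

record 'a ecgraph =
  underlying :: "'a ugraph"
  colour :: "'a set \<Rightarrow> nat"

(* The colouring is extensional, so that it is determined by its values on the edges. *)
definition edge_coloured_graph :: "nat \<Rightarrow> 'a ecgraph \<Rightarrow> bool" where
  "edge_coloured_graph m G \<longleftrightarrow> simple_graph (underlying G) \<and>
     colour G \<in> edges (underlying G) \<rightarrow>\<^sub>E {1..m}"

definition ecgraph_iso :: "'a ecgraph \<Rightarrow> 'b ecgraph \<Rightarrow> ('a \<Rightarrow> 'b) \<Rightarrow> bool" where
  "ecgraph_iso G G' f \<longleftrightarrow> graph_iso (underlying G) (underlying G') f \<and>
     (\<forall>e\<in>edges (underlying G). colour G' (f ` e) = colour G e)"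

definition ecgraph_isomorphic :: "'a ecgraph \<Rightarrow> 'b ecgraph \<Rightarrow> bool" where
  "ecgraph_isomorphic G G' \<longleftrightarrow> (\<exists>f. ecgraph_iso G G' f)"

definition switch :: "'a \<times> (nat \<Rightarrow> nat) \<Rightarrow> 'a ecgraph \<Rightarrow> 'a ecgraph" where
  "switch = (\<lambda>(x, \<pi>) G. G\<lparr>colour := (\<lambda>e. if e \<in> edges (underlying G) \<and> x \<in> e
     then \<pi> (colour G e) else colour G e)\<rparr>)"

definition switching_sequence ::
  "(nat \<Rightarrow> nat) set \<Rightarrow> 'a ecgraph \<Rightarrow> ('a \<times> (nat \<Rightarrow> nat)) list \<Rightarrow> bool" where
  "switching_sequence \<Gamma> G S \<longleftrightarrow> set S \<subseteq> verts (underlying G) \<times> \<Gamma>"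

definition switch_seq :: "('a \<times> (nat \<Rightarrow> nat)) list \<Rightarrow> 'a ecgraph \<Rightarrow> 'a ecgraph" where
  "switch_seq S G = fold switch S G"

(* For m-edge-coloured graphs, \<Gamma> is meant to be (the carrier of) a subgroup of sym_group m. *)
definition switch_equivalent ::
  "(nat \<Rightarrow> nat) set \<Rightarrow> 'a ecgraph \<Rightarrow> 'b ecgraph \<Rightarrow> bool" where
  "switch_equivalent \<Gamma> G G' \<longleftrightarrow>
     (\<exists>S. switching_sequence \<Gamma> G S \<and> ecgraph_isomorphic (switch_seq S G) G')"

end

theory Submission imports Defs begin

text \<open>
  Switching never touches the underlying graph, so switch equivalent graphs have isomorphic
  underlying graphs. For the converse it suffices that the colour of one edge can be changed at
  will while every other edge keeps its colour (\<open>recolour_edge\<close>): applied to the edges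
  one after another, this produces every colouring of the graph (\<open>recolour_edges\<close>), in
  particular the colouring pulled back from the second graph along an isomorphism of the
  underlying graphs.

  To recolour an edge \<open>{x, y}\<close>, switch at \<open>x\<close>, \<open>y\<close>, \<open>x\<close>,
  \<open>y\<close> in turn, with an involution \<open>\<pi>\<close> at \<open>x\<close> and an involution
  \<open>\<sigma>\<close> at \<open>y\<close>. In a simple graph no other edge contains both ends, so any other
  edge is acted on by \<open>\<pi> \<circ> \<pi> = id\<close>, by \<open>\<sigma> \<circ> \<sigma> = id\<close>, or
  not at all, whereas \<open>{x, y}\<close> is acted on by the commutator
  \<open>\<sigma> \<circ> \<pi> \<circ> \<sigma> \<circ> \<pi>\<close>. Two transpositions that share
  exactly one point have a 3-cycle as commutator, and three colours are enough to send any
  colour to any other in this way.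
\<close>

lemma underlying_switch [simp]: "underlying (switch s G) = underlying G"
  by (simp add: switch_def split: prod.split)

lemma underlying_switch_seq [simp]: "underlying (switch_seq S G) = underlying G"
  unfolding switch_seq_def by (induction S arbitrary: G) simp_all

lemma switch_seq_append: "switch_seq (S @ T) G = switch_seq T (switch_seq S G)"
  by (simp add: switch_seq_def)

text \<open>
  The commutator trick. Since the two involutions are their own inverses, alternating
  them twice cancels on every edge that contains only one of the ends.
\<close>

lemma switch_commutator:
  assumes "simple_graph (underlying G)" and xy: "{x, y} \<in> edges (underlying G)"
    and \<pi>: "\<pi> \<circ> \<pi> = id" and \<sigma>: "\<sigma> \<circ> \<sigma> = id"
  shows "switch_seq [(x, \<pi>), (y, \<sigma>), (x, \<pi>), (y, \<sigma>)] G =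
    G\<lparr>colour := (colour G)({x, y} := \<sigma> (\<pi> (\<sigma> (\<pi> (colour G {x, y})))))\<rparr>"
proof -
  have "card {x, y} = 2"
    using assms by (auto simp: simple_graph_def)
  then have "x \<noteq> y"
    by auto
  have only: "e = {x, y}" if "e \<in> edges (underlying G)" "x \<in> e" "y \<in> e" for e
  proof -
    have "card e = 2"
      using assms(1) that(1) by (simp add: simple_graph_def)
    moreover from this have "finite e"
      by (simp add: card_ge_0_finite)
    ultimately show ?thesis
      using that \<open>x \<noteq> y\<close> by (metis card_2_iff card_subset_eq empty_subsetI insert_subset)
  qed
  have invol: "\<pi> (\<pi> c) = c" "\<sigma> (\<sigma> c) = c" for c
    using \<pi> \<sigma> by (simp_all add: fun_eq_iff)
  have "colour (switch_seq [(x, \<pi>), (y, \<sigma>), (x, \<pi>), (y, \<sigma>)] G) e =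
      ((colour G)({x, y} := \<sigma> (\<pi> (\<sigma> (\<pi> (colour G {x, y})))))) e" for e
  proof (cases "e = {x, y}")
    case True
    then show ?thesis
      using xy by (simp add: switch_seq_def switch_def)
  next
    case False
    then have "e \<notin> edges (underlying G) \<or> x \<notin> e \<or> y \<notin> e"
      using only by blast
    then show ?thesis
      using False by (auto simp: switch_seq_def switch_def invol)
  qed
  then show ?thesis
    by (intro ecgraph.equality ext) simp_all
qed

text \<open>
  This is where three colours are needed: to turn colour \<open>a\<close> into
  \<open>b \<noteq> a\<close>, the two transpositions are \<open>(a d)\<close> and
  \<open>(a b)\<close> for a third colour \<open>d\<close>.
\<close>

lemma recolour_edge:
  assumes "m \<ge> 3" and simple: "simple_graph (underlying G)"
    and e: "e \<in> edges (underlying G)" and "colour G e \<in> {1..m}" and "b \<in> {1..m}"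
  obtains S where "switching_sequence (carrier (sym_group m)) G S"
    and "switch_seq S G = G\<lparr>colour := (colour G)(e := b)\<rparr>"
proof (cases "b = colour G e")
  case True
  show ?thesis
    by (rule that[of "[]"]) (simp_all add: switching_sequence_def switch_seq_def True)
next
  case False
  define a where "a = colour G e"
  have "\<not> {1..m} \<subseteq> {a, b}"
  proof
    assume "{1..m} \<subseteq> {a, b}"
    then have "card {1..m} \<le> card {a, b}"
      by (intro card_mono) simp_all
    also have "\<dots> \<le> 2"
      by (simp add: card_insert_if)
    finally show False
      using \<open>m \<ge> 3\<close> by simp
  qed
  then obtain d where d: "d \<in> {1..m}" "d \<noteq> a" "d \<noteq> b"
    by blast
  have "e \<subseteq> verts (underlying G)" "card e = 2"
    using simple e by (auto simp: simple_graph_def)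
  then obtain x y where xy: "e = {x, y}" "x \<in> verts (underlying G)" "y \<in> verts (underlying G)"
    by (auto simp: card_2_iff)
  define \<pi> \<sigma> where "\<pi> = transpose a d" and "\<sigma> = transpose a b"
  have "\<pi> permutes {1..m}" "\<sigma> permutes {1..m}"
    using assms d by (auto simp: \<pi>_def \<sigma>_def a_def intro!: permutes_swap_id)
  (* The colour of the edge travels a, d, d, a, b. *)
  moreover have "\<sigma> (\<pi> (\<sigma> (\<pi> a))) = b"
    using d by (simp add: \<pi>_def \<sigma>_def)
  ultimately show ?thesis
    using switch_commutator[OF simple, of x y \<pi> \<sigma>] e xy
    by (intro that[of "[(x, \<pi>), (y, \<sigma>), (x, \<pi>), (y, \<sigma>)]"])
      (simp_all add: switching_sequence_def sym_group_def a_def \<pi>_def \<sigma>_def)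
qed

lemma recolour_edges:
  assumes "m \<ge> 3" and simple: "simple_graph (underlying G)"
    and colour: "\<And>e. e \<in> edges (underlying G) \<Longrightarrow> colour G e \<in> {1..m}"
    and c: "\<And>e. e \<in> edges (underlying G) \<Longrightarrow> c e \<in> {1..m}"
    and "finite F" and "F \<subseteq> edges (underlying G)"
  shows "\<exists>S. switching_sequence (carrier (sym_group m)) G S \<and>
    switch_seq S G = G\<lparr>colour := override_on (colour G) c F\<rparr>"
  using \<open>finite F\<close> \<open>F \<subseteq> edges (underlying G)\<close>
proof (induction F)
  case empty
  show ?case
    by (rule exI[of _ "[]"]) (simp add: switching_sequence_def switch_seq_def)
next
  case (insert e F)
  then obtain S where S: "switching_sequence (carrier (sym_group m)) G S"
      "switch_seq S G = G\<lparr>colour := override_on (colour G) c F\<rparr>"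
    by auto
  define G1 where "G1 = switch_seq S G"
  obtain T where T: "switching_sequence (carrier (sym_group m)) G1 T"
      "switch_seq T G1 = G1\<lparr>colour := (colour G1)(e := c e)\<rparr>"
    using insert.prems insert.hyps simple colour[of e] c[of e]
    by (auto intro: recolour_edge[OF \<open>m \<ge> 3\<close>, of G1 e "c e"] simp: G1_def S(2))
  have "switch_seq (S @ T) G = G\<lparr>colour := override_on (colour G) c (insert e F)\<rparr>"
    using T(2) by (simp add: switch_seq_append G1_def S(2) override_on_insert)
  moreover have "switching_sequence (carrier (sym_group m)) G (S @ T)"
    using S(1) T(1) by (simp add: switching_sequence_def G1_def)
  ultimately show ?case
    by blast
qed

lemma finite_edges: "simple_graph H \<Longrightarrow> finite (edges H)"
  by (rule finite_subset[of _ "Pow (verts H)"]) (auto simp: simple_graph_def)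

lemma graph_iso_image_edge:
  assumes "simple_graph H" and "graph_iso H H' f" and "e \<in> edges H"
  shows "f ` e \<in> edges H'"
proof -
  have "e \<subseteq> verts H" "card e = 2"
    using assms by (auto simp: simple_graph_def)
  then obtain x y where "e = {x, y}" "x \<in> verts H" "y \<in> verts H"
    by (auto simp: card_2_iff)
  then show ?thesis
    using assms by (auto simp: graph_iso_def)
qed

theorem corollary2p2:
  fixes m :: nat and G :: "'a ecgraph" and G' :: "'b ecgraph"
  assumes "m \<ge> 3"
    and "edge_coloured_graph m G"
    and "edge_coloured_graph m G'"
  shows "switch_equivalent (carrier (sym_group m)) G G' \<longleftrightarrow>
    graph_isomorphic (underlying G) (underlying G')"
proof
  assume "switch_equivalent (carrier (sym_group m)) G G'"
  then show "graph_isomorphic (underlying G) (underlying G')"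
    by (auto simp: switch_equivalent_def ecgraph_isomorphic_def ecgraph_iso_def
        graph_isomorphic_def)
next
  assume "graph_isomorphic (underlying G) (underlying G')"
  then obtain f where f: "graph_iso (underlying G) (underlying G') f"
    by (auto simp: graph_isomorphic_def)
  have simple: "simple_graph (underlying G)"
    using assms by (simp add: edge_coloured_graph_def)
  have "colour G e \<in> {1..m}" "colour G' (f ` e) \<in> {1..m}" if "e \<in> edges (underlying G)" for e
    using assms(2,3) that graph_iso_image_edge[OF simple f that]
    unfolding edge_coloured_graph_def by (blast dest: PiE_mem)+
  then obtain S where "switching_sequence (carrier (sym_group m)) G S"
    and "switch_seq S G =
      G\<lparr>colour := override_on (colour G) (\<lambda>e. colour G' (f ` e)) (edges (underlying G))\<rparr>"
    using recolour_edges[OF \<open>m \<ge> 3\<close> simple, of "\<lambda>e. colour G' (f ` e)"]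
      finite_edges[OF simple] by blast
  moreover from this have "ecgraph_iso (switch_seq S G) G' f"
    using f by (simp add: ecgraph_iso_def)
  ultimately show "switch_equivalent (carrier (sym_group m)) G G'"
    unfolding switch_equivalent_def ecgraph_isomorphic_def by blast
qed

end
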